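(* Let $\operatorname{opt}$ be a choice function. If the normal form operator $\operatorname{norm}_{\operatorname{opt}}$ induced by $\operatorname{opt}$ is subtree perfect, then there exists a subtree perfect extensive form operator $\operatorname{ext}$ that is equivalent to $\operatorname{norm}_{\operatorname{opt}}$, i.e. such that $\operatorname{norm}_{\operatorname{opt}}(T)=\operatorname{nfd}(\operatorname{ext}(T))$ for every consistent decision tree $T$.
   Context: **Gambles.** $\Omega$ is a finite set (the possibility space); subsets of $\Omega$ are events. $\mathcal{R}$ is an arbitrary set of rewards. A gamble is a function $X\colon\Omega\to\mathcal{R}$. For an event $E$ and a gamble $X$, $EX$ is the restriction of $X$ to $E$, and $\oplus$ combines partial maps with disjoint domains: if $E_1,\dots,E_n$ is a partition of $\Omega$, $\bigoplus_{i=1}^n E_iX_i$ is the gamble that equals $X_i$ on each $E_i$. For sets of gambles, $\bigoplus_{i=1}^n E_i\mathcal{X}_i=\{\bigoplus_{i=1}^n E_iX_i\colon X_i\in\mathcal{X}_i\}$. **Choice functions.** A choice function $\operatorname{opt}$ maps every non-empty finite set $\mathcal{X}$ of gambles and every non-empty event $A$ to a set $\operatorname{opt}(\mathcal{X}|A)$ with $\emptyset\neq\operatorname{opt}(\mathcal{X}|A)\subseteq\mathcal{X}$. **Decision trees.** A decision tree is a finite rooted tree whose leaves carry rewards in $\mathcal{R}$ and whose other nodes are decision nodes or chance nodes; the arcs out of a chance node are labelled by events forming a finite partition of $\Omega$. Each tree $T$ carries an event $\operatorname{ev}(T)$ (the intersection of all events on chance arcs that have preceded $T$). $T=\bigsqcup_{i=1}^n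 T_i$ means the root of $T$ is a decision node with subtrees $T_i$ at its children; then $\operatorname{ev}(T_i)=\operatorname{ev}(T)$. $T=\bigodot_{i=1}^n E_iT_i$ means the root is a chance node with $T_i$ attached by the arc labelled $E_i$; then $\operatorname{ev}(T_i)=\operatorname{ev}(T)\cap E_i$. For a node $N$ of $T$, $\operatorname{st}_N(T)$ is the subtree of $T$ at $N$ (remove all non-descendants of $N$), with $\operatorname{ev}(\operatorname{st}_N(T))$ the intersection of $\operatorname{ev}(T)$ with all events on chance arcs on the path from the root of $T$ to $N$. $T$ is consistent if $\operatorname{ev}(\operatorname{st}_N(T))\neq\emptyset$ for every node $N$ of $T$. For a set $\mathcal{T}$ of trees, $\operatorname{st}_N(\mathcal{T})=\{\operatorname{st}_N(T)\colon T\in\mathcal{T},\ N\text{ in }T\}$. **Extensive and normal form.** An extensive form solution of $T$ is a subtree of $T$ with the same root (and the same $\operatorname{ev}$) in which at each decision node that remains a non-empty subset of its arcs is kept and at each chance node that remains all arcs are kept; its nodes are regarded as nodes of $T$. A normal form decision of $T$ is an extensive form solution with exactly one arc out of each decision node; $\operatorname{nfd}(T)$ is the set of all of them. An extensive form operator maps each decision tree to an extensive form solution of it; a normal form operator maps each decision tree $T$ in its domain (which includes all consistent trees) to a subset of $\operatorname{nfd}(T)$. $\operatorname{gamb}(T)$ is defined recursively: $\{r\}$ (constant gamble) if $T$ is a leaf with reward $r$; $\operatorname{gamb}(\bigodot_{i} E_iT_i)=\bigoplus_{i} E_i\operatorname{gamb}(T_i)$; $\operatorname{gamb}(\bigsqcup_i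 T_i)=\bigcup_i\operatorname{gamb}(T_i)$. For a tree $T$ with $\operatorname{ev}(T)\neq\emptyset$, $$\operatorname{norm}_{\operatorname{opt}}(T)=\{U\in\operatorname{nfd}(T)\colon\operatorname{gamb}(U)\subseteq\operatorname{opt}(\operatorname{gamb}(T)|\operatorname{ev}(T))\}.$$ **Subtree perfectness.** A normal form operator $\operatorname{norm}$ is subtree perfect if for every consistent decision tree $T$ and every node $N$ in at least one element of $\operatorname{norm}(T)$, $\operatorname{st}_N(\operatorname{norm}(T))=\operatorname{norm}(\operatorname{st}_N(T))$. An extensive form operator $\operatorname{ext}$ is subtree perfect if for every consistent decision tree $T$ and every node $N$ in $\operatorname{ext}(T)$, $\operatorname{st}_N(\operatorname{ext}(T))=\operatorname{ext}(\operatorname{st}_N(T))$. *)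

theory Defs
  imports "HOL-Library.Finite_Map" "HOL-Library.Disjoint_Sets"
begin

text \<open>The possibility space is the universe of the type \<open>'w\<close>, and the set of rewards is the universe
  of the type \<open>'r\<close>.\<close>

type_synonym ('w, 'r) gamble = "'w \<Rightarrow> 'r"

definition choice_function ::
    "(('w, 'r) gamble set \<Rightarrow> 'w set \<Rightarrow> ('w, 'r) gamble set) \<Rightarrow> bool" where
  "choice_function opt \<longleftrightarrow>
     (\<forall>X A. finite X \<and> X \<noteq> {} \<and> A \<noteq> {} \<longrightarrow> opt X A \<noteq> {} \<and> opt X A \<subseteq> X)"

text \<open>The arcs out of a decision node carry names, and the arcs out of a chance node carry their
  events. Pruning a tree keeps these names, so that a node of a pruned tree is the same node of the
  original tree (even when a decision node has several isomorphic subtrees).\<close>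

datatype ('w, 'r) tree =
    Reward 'r
  | Decision "(nat, ('w, 'r) tree) fmap"
  | Chance "('w set, ('w, 'r) tree) fmap"

inductive wf_tree :: "('w, 'r) tree \<Rightarrow> bool" where
  "wf_tree (Reward r)"
| "m \<noteq> fmempty \<Longrightarrow> \<forall>t \<in> fmran' m. wf_tree t \<Longrightarrow> wf_tree (Decision m)"
| "partition_on UNIV (fmdom' m) \<Longrightarrow> \<forall>t \<in> fmran' m. wf_tree t \<Longrightarrow> wf_tree (Chance m)"

text \<open>A decision tree consists of its event and of its structure. The events of its subtrees are
  determined by these; see \<open>subtree_at\<close>.\<close>

type_synonym ('w, 'r) dtree = "'w set \<times> ('w, 'r) tree"

definition ev :: "('w, 'r) dtree \<Rightarrow> 'w set" where
  "ev T = fst T"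

definition decision_tree :: "('w, 'r) dtree \<Rightarrow> bool" where
  "decision_tree T \<longleftrightarrow> wf_tree (snd T)"

text \<open>A node is given by the path of arcs that leads to it from the root.\<close>

datatype 'w arc = Decision_Arc nat | Chance_Arc "'w set"

type_synonym 'w node = "'w arc list"

fun subtree_at :: "'w node \<Rightarrow> ('w, 'r) dtree \<Rightarrow> ('w, 'r) dtree option" where
  "subtree_at [] T = Some T"
| "subtree_at (Decision_Arc i # N) (A, Decision m) =
     Option.bind (fmlookup m i) (\<lambda>t. subtree_at N (A, t))"
| "subtree_at (Chance_Arc E # N) (A, Chance m) =
     Option.bind (fmlookup m E) (\<lambda>t. subtree_at N (A \<inter> E, t))"
| "subtree_at _ _ = None"

definition nodes :: "('w, 'r) dtree \<Rightarrow> 'w node set" where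
  "nodes T = {N. subtree_at N T \<noteq> None}"

definition st :: "'w node \<Rightarrow> ('w, 'r) dtree \<Rightarrow> ('w, 'r) dtree" where
  "st N T = the (subtree_at N T)"

definition st_set :: "'w node \<Rightarrow> ('w, 'r) dtree set \<Rightarrow> ('w, 'r) dtree set" where
  "st_set N \<T> = {st N T | T. T \<in> \<T> \<and> N \<in> nodes T}"

definition consistent :: "('w, 'r) dtree \<Rightarrow> bool" where
  "consistent T \<longleftrightarrow> decision_tree T \<and> (\<forall>N \<in> nodes T. ev (st N T) \<noteq> {})"

text \<open>\<open>pruning s t\<close>: \<open>s\<close> arises from \<open>t\<close> by keeping a non-empty set \<open>I\<close> of arcs at each remaining
  decision node and all arcs at each remaining chance node.\<close>

inductive pruning :: "('w, 'r) tree \<Rightarrow> ('w, 'r) tree \<Rightarrow> bool" where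
  "pruning (Reward r) (Reward r)"
| "I \<noteq> {} \<Longrightarrow> I \<subseteq> fmdom' m \<Longrightarrow> fmrel pruning m' (fmrestrict_set I m) \<Longrightarrow>
     pruning (Decision m') (Decision m)"
| "fmrel pruning m' m \<Longrightarrow> pruning (Chance m') (Chance m)"

definition extensive_form_solutions :: "('w, 'r) dtree \<Rightarrow> ('w, 'r) dtree set" where
  "extensive_form_solutions T = {U. ev U = ev T \<and> pruning (snd U) (snd T)}"

inductive single_arcs :: "('w, 'r) tree \<Rightarrow> bool" where
  "single_arcs (Reward r)"
| "card (fmdom' m) = 1 \<Longrightarrow> \<forall>t \<in> fmran' m. single_arcs t \<Longrightarrow> single_arcs (Decision m)"
| "\<forall>t \<in> fmran' m. single_arcs t \<Longrightarrow> single_arcs (Chance m)"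

definition nfd :: "('w, 'r) dtree \<Rightarrow> ('w, 'r) dtree set" where
  "nfd T = {U \<in> extensive_form_solutions T. single_arcs (snd U)}"

text \<open>For a family of sets of gambles indexed by the members of a partition, \<open>oplus\<close> is the set of
  all gambles that agree on each member \<open>E\<close> with some gamble in the set at \<open>E\<close>.\<close>

definition oplus :: "('w set, ('w, 'r) gamble set) fmap \<Rightarrow> ('w, 'r) gamble set" where
  "oplus \<X> = {X. \<forall>E \<in> fmdom' \<X>. \<exists>Y \<in> the (fmlookup \<X> E). \<forall>\<omega> \<in> E. X \<omega> = Y \<omega>}"

primrec gamb :: "('w, 'r) tree \<Rightarrow> ('w, 'r) gamble set" where
  "gamb (Reward r) = {\<lambda>_. r}"
| "gamb (Decision m) = \<Union> (fmran' (fmmap gamb m))"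
| "gamb (Chance m) = oplus (fmmap gamb m)"

definition norm_opt ::
    "(('w, 'r) gamble set \<Rightarrow> 'w set \<Rightarrow> ('w, 'r) gamble set) \<Rightarrow>
      ('w, 'r) dtree \<Rightarrow> ('w, 'r) dtree set" where
  "norm_opt opt T = {U \<in> nfd T. gamb (snd U) \<subseteq> opt (gamb (snd T)) (ev T)}"

definition normal_form_subtree_perfect ::
    "(('w, 'r) dtree \<Rightarrow> ('w, 'r) dtree set) \<Rightarrow> bool" where
  "normal_form_subtree_perfect norm \<longleftrightarrow>
     (\<forall>T N. consistent T \<and> (\<exists>U \<in> norm T. N \<in> nodes U) \<longrightarrow>
        st_set N (norm T) = norm (st N T))"

definition extensive_form_operator :: "(('w, 'r) dtree \<Rightarrow> ('w, 'r) dtree) \<Rightarrow> bool" where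
  "extensive_form_operator ext \<longleftrightarrow>
     (\<forall>T. decision_tree T \<longrightarrow> ext T \<in> extensive_form_solutions T)"

definition extensive_form_subtree_perfect ::
    "(('w, 'r) dtree \<Rightarrow> ('w, 'r) dtree) \<Rightarrow> bool" where
  "extensive_form_subtree_perfect ext \<longleftrightarrow>
     (\<forall>T N. consistent T \<and> N \<in> nodes (ext T) \<longrightarrow> st N (ext T) = ext (st N T))"

end

theory Submission
  imports Defs
begin

text \<open>The operator \<open>ext\<close> keeps, at each decision node that it reaches, exactly the arcs used by some
  optimal normal form decision of the subtree at that node. Below a decision node, subtree
  perfectness gives \<open>norm T = nfd (ext T)\<close> at once. At a chance node it only yields the projections of
  \<open>norm T\<close> to the branches, whereas \<open>nfd (ext T)\<close> is their full product. That \<open>norm T\<close> is a product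
  follows by exchanging the branches of an optimal decision one at a time. To exchange the branch
  at \<open>E\<close>, fix the others as prescribed by the decision and leave the branch at \<open>E\<close> undecided; offering
  this tree and \<open>T\<close> as two options of a decision node gives a tree with the same gambles as \<open>T\<close>, to
  which subtree perfectness applies.\<close>

section \<open>Unfolding rules for trees, finite maps and sets of gambles\<close>

lemma pruning_simps:
  "pruning u (Reward r) \<longleftrightarrow> u = Reward r"
  "pruning u (Decision m) \<longleftrightarrow>
     (\<exists>m' I. u = Decision m' \<and> I \<noteq> {} \<and> I \<subseteq> fmdom' m \<and> fmrel pruning m' (fmrestrict_set I m))"
  "pruning u (Chance n) \<longleftrightarrow> (\<exists>n'. u = Chance n' \<and> fmrel pruning n' n)"
  by (subst pruning.simps, simp; blast)+

lemma single_arcs_simps: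
  "single_arcs (Reward r)"
  "single_arcs (Decision m) \<longleftrightarrow> card (fmdom' m) = 1 \<and> (\<forall>t \<in> fmran' m. single_arcs t)"
  "single_arcs (Chance n) \<longleftrightarrow> (\<forall>t \<in> fmran' n. single_arcs t)"
  by (subst single_arcs.simps; auto)+

lemma wf_tree_simps:
  "wf_tree (Reward r)"
  "wf_tree (Decision m) \<longleftrightarrow> m \<noteq> fmempty \<and> (\<forall>t \<in> fmran' m. wf_tree t)"
  "wf_tree (Chance n) \<longleftrightarrow> partition_on UNIV (fmdom' n) \<and> (\<forall>t \<in> fmran' n. wf_tree t)"
  by (subst wf_tree.simps; auto)+

lemma fmrelD:
  assumes "fmrel R m n"
  shows "fmlookup m x = Some a \<Longrightarrow> \<exists>b. fmlookup n x = Some b \<and> R a b"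
    and "fmlookup n x = Some b \<Longrightarrow> \<exists>a. fmlookup m x = Some a \<and> R a b"
  using assms[unfolded fmrel_iff, rule_format, of x] by (auto simp: option_rel_Some1 option_rel_Some2)

text \<open>The second premise only has to equate the domains: lookups are single-valued, so the
  relation itself comes from the first.\<close>

lemma fmrelI:
  assumes "\<And>x a. fmlookup m x = Some a \<Longrightarrow> \<exists>b. fmlookup n x = Some b \<and> R a b"
    and "\<And>x b. fmlookup n x = Some b \<Longrightarrow> \<exists>a. fmlookup m x = Some a"
  shows "fmrel R m n"
  unfolding fmrel_iff
proof
  fix x
  show "rel_option R (fmlookup m x) (fmlookup n x)"
    using assms[of x] by (cases "fmlookup m x"; cases "fmlookup n x") auto
qed

lemma mem_gamb_Decision:
  "X \<in> gamb (Decision m) \<longleftrightarrow> (\<exists>i t. fmlookup m i = Some t \<and> X \<in> gamb t)"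
  by (simp add: fmlookup_ran'_iff Bex_def) blast

lemma mem_gamb_Chance:
  "X \<in> gamb (Chance m) \<longleftrightarrow>
     (\<forall>E t. fmlookup m E = Some t \<longrightarrow> (\<exists>Y \<in> gamb t. \<forall>\<omega> \<in> E. X \<omega> = Y \<omega>))"
proof -
  have "X \<in> gamb (Chance m) \<longleftrightarrow>
      (\<forall>E \<in> fmdom' m. \<exists>Y \<in> the (fmlookup (fmmap gamb m) E). \<forall>\<omega> \<in> E. X \<omega> = Y \<omega>)"
    by (simp add: oplus_def)
  also have "\<dots> \<longleftrightarrow> (\<forall>E t. fmlookup m E = Some t \<longrightarrow>
      (\<exists>Y \<in> the (fmlookup (fmmap gamb m) E). \<forall>\<omega> \<in> E. X \<omega> = Y \<omega>))"
    unfolding Ball_def fmlookup_dom'_iff by blast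
  finally show ?thesis by simp
qed

section \<open>Nodes, subtrees and consistency\<close>

lemma nodes_simps:
  "[] \<in> nodes T"
  "N \<in> nodes (A, Reward r) \<longleftrightarrow> N = []"
  "Decision_Arc i # N \<in> nodes (A, Decision m) \<longleftrightarrow>
     (\<exists>t. fmlookup m i = Some t \<and> N \<in> nodes (A, t))"
  "Chance_Arc E # N \<in> nodes (A, Decision m) \<longleftrightarrow> False"
  "Chance_Arc E # N \<in> nodes (A, Chance n) \<longleftrightarrow>
     (\<exists>t. fmlookup n E = Some t \<and> N \<in> nodes (A \<inter> E, t))"
  "Decision_Arc i # N \<in> nodes (A, Chance n) \<longleftrightarrow> False"
  by (auto simp: nodes_def bind_eq_Some_conv) (cases N; simp)

lemma st_simps:
  "st [] T = T"
  "fmlookup m i = Some t \<Longrightarrow> st (Decision_Arc i # N) (A, Decision m) = st N (A, t)"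
  "fmlookup n E = Some t \<Longrightarrow> st (Chance_Arc E # N) (A, Chance n) = st N (A \<inter> E, t)"
  by (auto simp: st_def)

lemma consistent_ev: "consistent (A, t) \<Longrightarrow> A \<noteq> {}"
  unfolding consistent_def ev_def by (metis fst_conv nodes_simps(1) st_simps(1))

lemma consistent_wf: "consistent (A, t) \<Longrightarrow> wf_tree t"
  by (simp add: consistent_def decision_tree_def)

lemma consistent_Reward: "consistent (A, Reward r) \<longleftrightarrow> A \<noteq> {}"
  by (auto simp: consistent_def decision_tree_def wf_tree_simps nodes_simps st_simps ev_def)

text \<open>A node is the root or lies beyond a first arc, so the condition on all nodes splits over
  the children. This opens consistency to structural induction on trees.\<close>

lemma consistent_Decision:
  "consistent (A, Decision m) \<longleftrightarrow> A \<noteq> {} \<and> m \<noteq> fmempty \<and>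
     (\<forall>i t. fmlookup m i = Some t \<longrightarrow> consistent (A, t))" (is "?L \<longleftrightarrow> ?R")
proof
  assume L: ?L
  have "consistent (A, t)" if t: "fmlookup m i = Some t" for i t
    unfolding consistent_def
  proof (intro conjI ballI)
    show "decision_tree (A, t)"
      using consistent_wf[OF L] t by (auto simp: decision_tree_def wf_tree_simps fmlookup_ran'_iff)
    fix N assume "N \<in> nodes (A, t)"
    with t have "Decision_Arc i # N \<in> nodes (A, Decision m)" by (simp add: nodes_simps)
    with L show "ev (st N (A, t)) \<noteq> {}" unfolding consistent_def using st_simps(2)[OF t] by metis
  qed
  then show ?R using consistent_ev[OF L] consistent_wf[OF L] by (simp add: wf_tree_simps)
next
  assume R: ?R
  show ?L unfolding consistent_def
  proof (intro conjI ballI)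
    show "decision_tree (A, Decision m)"
      using R by (simp add: decision_tree_def wf_tree_simps fmlookup_ran'_iff) (blast intro: consistent_wf)
    fix N assume N: "N \<in> nodes (A, Decision m)"
    show "ev (st N (A, Decision m)) \<noteq> {}"
    proof (cases N)
      case Nil
      then show ?thesis using R by (simp add: st_simps ev_def)
    next
      case (Cons a N')
      with N obtain i t where "a = Decision_Arc i" "fmlookup m i = Some t" "N' \<in> nodes (A, t)"
        by (cases a) (auto simp: nodes_simps)
      then show ?thesis using R Cons by (auto simp: st_simps consistent_def)
    qed
  qed
qed

lemma consistent_Chance:
  "consistent (A, Chance m) \<longleftrightarrow> A \<noteq> {} \<and> partition_on UNIV (fmdom' m) \<and>
     (\<forall>E t. fmlookup m E = Some t \<longrightarrow> consistent (A \<inter> E, t))" (is "?L \<longleftrightarrow> ?R")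
proof
  assume L: ?L
  have "consistent (A \<inter> E, t)" if t: "fmlookup m E = Some t" for E t
    unfolding consistent_def
  proof (intro conjI ballI)
    show "decision_tree (A \<inter> E, t)"
      using consistent_wf[OF L] t by (auto simp: decision_tree_def wf_tree_simps fmlookup_ran'_iff)
    fix N assume "N \<in> nodes (A \<inter> E, t)"
    with t have "Chance_Arc E # N \<in> nodes (A, Chance m)" by (simp add: nodes_simps)
    with L show "ev (st N (A \<inter> E, t)) \<noteq> {}" unfolding consistent_def using st_simps(3)[OF t] by metis
  qed
  then show ?R using consistent_ev[OF L] consistent_wf[OF L] by (simp add: wf_tree_simps)
next
  assume R: ?R
  show ?L unfolding consistent_def
  proof (intro conjI ballI)
    show "decision_tree (A, Chance m)"
      using R by (simp add: decision_tree_def wf_tree_simps fmlookup_ran'_iff) (blast intro: consistent_wf)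
    fix N assume N: "N \<in> nodes (A, Chance m)"
    show "ev (st N (A, Chance m)) \<noteq> {}"
    proof (cases N)
      case Nil
      then show ?thesis using R by (simp add: st_simps ev_def)
    next
      case (Cons a N')
      with N obtain E t where "a = Chance_Arc E" "fmlookup m E = Some t" "N' \<in> nodes (A \<inter> E, t)"
        by (cases a) (auto simp: nodes_simps)
      then show ?thesis using R Cons by (auto simp: st_simps consistent_def)
    qed
  qed
qed

section \<open>Prunings and their gambles\<close>

lemma pruning_refl: "wf_tree t \<Longrightarrow> pruning t t"
proof (induction t)
  case (Decision m)
  have "fmrel pruning m (fmrestrict_set (fmdom' m) m)"
    using Decision by (intro fmrelI) (auto simp: wf_tree_simps fmlookup_ran'_iff fmlookup_dom'_iff split: if_splits)
  moreover have "fmdom' m \<noteq> {}"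
    using Decision by (metis emptyE fmap_ext fmdom'_notD fmempty_lookup wf_tree_simps(2))
  ultimately show ?case unfolding pruning_simps by blast
next
  case (Chance m)
  then have "fmrel pruning m m" by (intro fmrelI) (auto simp: wf_tree_simps fmlookup_ran'_iff)
  then show ?case unfolding pruning_simps by blast
qed (simp add: pruning_simps)

text \<open>Pruning drops members of the union at decision nodes, and \<open>oplus\<close> is
  monotone in every branch.\<close>

lemma pruning_gamb: "pruning u t \<Longrightarrow> gamb u \<subseteq> gamb t"
proof (induction t arbitrary: u)
  case (Decision m)
  then obtain m' I where u: "u = Decision m'" and r: "fmrel pruning m' (fmrestrict_set I m)"
    unfolding pruning_simps by blast
  show ?case
  proof
    fix X assume "X \<in> gamb u"
    then obtain i v where "fmlookup m' i = Some v" and X: "X \<in> gamb v"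
      unfolding u mem_gamb_Decision by blast
    with fmrelD(1)[OF r] obtain t where t: "fmlookup m i = Some t" "pruning v t"
      by (fastforce split: if_splits)
    with Decision.IH X show "X \<in> gamb (Decision m)"
      unfolding mem_gamb_Decision by (blast intro: fmran'I)
  qed
next
  case (Chance m)
  then obtain m' where u: "u = Chance m'" and r: "fmrel pruning m' m"
    unfolding pruning_simps by blast
  show ?case unfolding u
    by (auto simp only: mem_gamb_Chance) (meson fmrelD(2)[OF r] Chance.IH fmran'I subsetD)
qed (simp add: pruning_simps)

text \<open>All arcs survive at chance nodes, so partitions and events are unchanged, and each
  surviving decision node keeps an arc. Thus subtree perfectness also applies to pruned
  trees.\<close>

lemma pruning_consistent: "consistent (A, t) \<Longrightarrow> pruning u t \<Longrightarrow> consistent (A, u)"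
proof (induction t arbitrary: u A)
  case (Decision m)
  then obtain m' I where u: "u = Decision m'" and I: "I \<noteq> {}" "I \<subseteq> fmdom' m"
    and r: "fmrel pruning m' (fmrestrict_set I m)"
    unfolding pruning_simps by blast
  from I obtain i where "i \<in> I" "i \<in> fmdom' m" by blast
  then obtain t where "fmlookup m i = Some t" by (auto simp: fmlookup_dom'_iff)
  with \<open>i \<in> I\<close> have "fmlookup (fmrestrict_set I m) i = Some t" by simp
  from fmrelD(2)[OF r this] have "m' \<noteq> fmempty" by auto
  moreover have "consistent (A, v)" if v: "fmlookup m' j = Some v" for j v
  proof -
    from fmrelD(1)[OF r v] obtain t where "fmlookup m j = Some t" "pruning v t"
      by (auto split: if_splits)
    with Decision show ?thesis unfolding consistent_Decision by (meson fmran'I)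
  qed
  ultimately show ?case using Decision.prems by (auto simp: u consistent_Decision)
next
  case (Chance m)
  then obtain m' where u: "u = Chance m'" and r: "fmrel pruning m' m"
    unfolding pruning_simps by blast
  have "fmdom' m' = fmdom' m"
    using fmrel_fmdom'_eq[OF r] .
  moreover have "consistent (A \<inter> E, v)" if v: "fmlookup m' E = Some v" for E v
  proof -
    from fmrelD(1)[OF r v] obtain t where "fmlookup m E = Some t" "pruning v t" by blast
    with Chance show ?thesis unfolding consistent_Chance by (meson fmran'I)
  qed
  ultimately show ?case using Chance.prems by (auto simp: u consistent_Chance)
qed (simp add: pruning_simps)

text \<open>Together with \<open>gamb_nonempty\<close>, this makes \<open>gamb t\<close> an
  admissible argument of a choice function.\<close>

lemma finite_gamb:
  fixes t :: "('w::finite, 'r) tree"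
  shows "wf_tree t \<Longrightarrow> finite (gamb t)"
proof (induction t)
  case (Decision m)
  have "gamb (Decision m) = (\<Union>t\<in>fmran' m. gamb t)"
    by (auto simp: fmlookup_ran'_iff)
  with Decision show ?case by (simp add: wf_tree_simps fmran'_alt_def)
next
  case (Chance m)
  \<comment> \<open>\<open>?V\<close> collects all values of the gambles of the branches. The events
    cover the possibility space, so gambles of the chance node take values in \<open>?V\<close>
    only, and a finite possibility space admits finitely many functions into
    \<open>?V\<close>.\<close>
  let ?V = "(\<lambda>(Y, \<omega>). Y \<omega>) ` ((\<Union>t\<in>fmran' m. gamb t) \<times> UNIV)"
  have "finite ?V" using Chance by (simp add: wf_tree_simps fmran'_alt_def)
  moreover have "gamb (Chance m) \<subseteq> {X. range X \<subseteq> ?V}"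
  proof clarify
    fix X \<omega> assume X: "X \<in> gamb (Chance m)"
    from Chance.prems obtain E t where "\<omega> \<in> E" "fmlookup m E = Some t"
      unfolding wf_tree_simps partition_on_def by (metis UNIV_I UnionE fmlookup_dom'_iff)
    with X obtain Y where "Y \<in> gamb t" "X \<omega> = Y \<omega>" unfolding mem_gamb_Chance by blast
    moreover have "t \<in> fmran' m" using \<open>fmlookup m E = Some t\<close> by (rule fmran'I)
    ultimately show "X \<omega> \<in> ?V" by (intro image_eqI[of _ _ "(Y, \<omega>)"]) auto
  qed
  moreover have "finite {X :: 'w \<Rightarrow> 'r. range X \<subseteq> V}" if "finite V" for V
    using finite_set_of_finite_funs[OF finite that, of UNIV] by (simp add: image_subset_iff)
  ultimately show ?case by (blast intro: finite_subset)
qed simp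

lemma gamb_nonempty: "wf_tree t \<Longrightarrow> gamb t \<noteq> {}"
proof (induction t)
  case (Decision m)
  then obtain i t where "fmlookup m i = Some t"
    by (metis fmempty_lookup fmap_ext not_Some_eq wf_tree_simps(2))
  moreover from this Decision have "gamb t \<noteq> {}" by (auto simp: wf_tree_simps intro: fmran'I)
  ultimately show ?case
    unfolding ex_in_conv[symmetric] mem_gamb_Decision by blast
next
  case (Chance m)
  \<comment> \<open>One gamble \<open>Y E\<close> is picked per branch, and these are glued along
    the partition; disjointness makes the \<open>THE\<close> below select the intended
    event.\<close>
  define Y where "Y E = (SOME Y. Y \<in> gamb (the (fmlookup m E)))" for E
  have Y: "Y E \<in> gamb t" if "fmlookup m E = Some t" for E t
    using Chance that unfolding Y_def wf_tree_simps by (auto simp: some_in_eq intro: fmran'I)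
  define X where "X \<omega> = Y (THE E. E \<in> fmdom' m \<and> \<omega> \<in> E) \<omega>" for \<omega>
  have "X \<omega> = Y E \<omega>" if "E \<in> fmdom' m" "\<omega> \<in> E" for E \<omega>
  proof -
    have "(THE E. E \<in> fmdom' m \<and> \<omega> \<in> E) = E"
      using that Chance.prems by (intro the_equality) (auto simp: wf_tree_simps partition_on_def disjoint_def)
    then show ?thesis by (simp add: X_def)
  qed
  with Y have "X \<in> gamb (Chance m)" unfolding mem_gamb_Chance by (metis fmdom'I)
  then show ?case by blast
qed simp

section \<open>Normal form decisions\<close>

definition normal_form :: "('w, 'r) tree \<Rightarrow> ('w, 'r) tree \<Rightarrow> bool" where
  "normal_form u t \<longleftrightarrow> pruning u t \<and> single_arcs u"

lemma mem_nfd: "(B, u) \<in> nfd (A, t) \<longleftrightarrow> B = A \<and> normal_form u t"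
  by (auto simp: nfd_def extensive_form_solutions_def normal_form_def ev_def)

lemma mem_norm_opt:
  "(B, u) \<in> norm_opt opt (A, t) \<longleftrightarrow>
     B = A \<and> normal_form u t \<and> gamb u \<subseteq> opt (gamb t) A"
  by (auto simp: norm_opt_def mem_nfd ev_def)

lemma normal_form_Reward: "normal_form u (Reward r) \<longleftrightarrow> u = Reward r"
  by (auto simp: normal_form_def pruning_simps single_arcs_simps)

lemma normal_form_Decision:
  "normal_form u (Decision m) \<longleftrightarrow>
     (\<exists>i t v. fmlookup m i = Some t \<and> normal_form v t \<and> u = Decision (fmupd i v fmempty))"
  (is "?L \<longleftrightarrow> ?R")
proof
  assume ?L
  then obtain m' I where u: "u = Decision m'" and r: "fmrel pruning m' (fmrestrict_set I m)"
    and s: "card (fmdom' m') = 1" "\<forall>t \<in> fmran' m'. single_arcs t"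
    unfolding normal_form_def pruning_simps by (metis single_arcs_simps(2))
  from s obtain i where i: "fmdom' m' = {i}" by (auto simp: card_1_singleton_iff)
  then obtain v where v: "fmlookup m' i = Some v" by (metis fmlookup_dom'_iff insertI1)
  have m': "m' = fmupd i v fmempty"
  proof (rule fmap_ext)
    fix x show "fmlookup m' x = fmlookup (fmupd i v fmempty) x"
      using i v by (cases "x = i") (auto simp: fmdom'_notD)
  qed
  from fmrelD(1)[OF r v] obtain t where "fmlookup m i = Some t" "pruning v t"
    by (auto split: if_splits)
  moreover have "single_arcs v" using s v by (auto intro: fmran'I)
  ultimately show ?R using u m' unfolding normal_form_def by blast
next
  assume ?R
  then obtain i t v where t: "fmlookup m i = Some t" and v: "normal_form v t"
    and u: "u = Decision (fmupd i v fmempty)" by blast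
  have "fmrel pruning (fmupd i v fmempty) (fmrestrict_set {i} m)"
    using t v by (intro fmrelI) (auto simp: normal_form_def split: if_splits)
  then have "pruning u (Decision m)"
    unfolding pruning_simps u using t by (intro exI[of _ "fmupd i v fmempty"] exI[of _ "{i}"]) (auto intro: fmdom'I)
  moreover have "single_arcs u"
    using v by (auto simp: u single_arcs_simps normal_form_def fmlookup_ran'_iff split: if_splits)
  ultimately show ?L by (simp add: normal_form_def)
qed

lemma normal_form_Chance:
  "normal_form u (Chance m) \<longleftrightarrow> (\<exists>m'. u = Chance m' \<and> fmrel normal_form m' m)" (is "?L \<longleftrightarrow> ?R")
proof
  assume ?L
  then obtain m' where u: "u = Chance m'" and r: "fmrel pruning m' m"
    and s: "\<forall>t \<in> fmran' m'. single_arcs t"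
    unfolding normal_form_def pruning_simps by (auto simp: single_arcs_simps)
  have "fmrel normal_form m' m"
    using r by (rule fmap.rel_mono_strong) (use s in \<open>simp add: normal_form_def fmran'_alt_def\<close>)
  with u show ?R by blast
next
  assume ?R
  then obtain m' where u: "u = Chance m'" and r: "fmrel normal_form m' m" by blast
  have "fmrel pruning m' m"
    using r by (rule fmap.rel_mono_strong) (simp add: normal_form_def)
  moreover have "single_arcs u"
    using fmrelD(1)[OF r] by (fastforce simp: u single_arcs_simps normal_form_def fmlookup_ran'_iff)
  ultimately show ?L by (auto simp: normal_form_def pruning_simps u)
qed

text \<open>At a decision node with a single arc nothing more can be removed. This pins down the
  branches that are already decided when another branch is exchanged.\<close>

lemma normal_form_single_arcs: "single_arcs t \<Longrightarrow> normal_form u t \<Longrightarrow> u = t"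
proof (induction t arbitrary: u)
  case (Decision m)
  then obtain i t v where t: "fmlookup m i = Some t" and v: "normal_form v t"
    and u: "u = Decision (fmupd i v fmempty)" unfolding normal_form_Decision by blast
  have "v = t" using Decision t v by (auto simp: single_arcs_simps intro: fmran'I)
  moreover have "fmdom' m = {i}"
    using Decision.prems(1) fmdom'I[OF t] by (auto simp: single_arcs_simps card_1_singleton_iff)
  ultimately have "m = fmupd i v fmempty"
    using t by (intro fmap_ext) (auto simp: fmdom'_notD)
  with u show ?case by simp
next
  case (Chance m)
  then obtain m' where u: "u = Chance m'" and r: "fmrel normal_form m' m"
    unfolding normal_form_Chance by blast
  have "m' = m"
  proof (rule fmap_ext)
    fix E
    show "fmlookup m' E = fmlookup m E"
    proof (cases "fmlookup m E")
      case None
      then show ?thesis using fmrelD(1)[OF r] by (metis not_Some_eq)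
    next
      case (Some t)
      with fmrelD(2)[OF r] Chance show ?thesis
        by (metis fmran'I single_arcs_simps(3))
    qed
  qed
  with u show ?case by simp
qed (simp add: normal_form_Reward)

text \<open>The decision follows one derivation of \<open>X\<close>: at a decision node an arc whose
  subtree yields \<open>X\<close>, at a chance node for each event a gamble agreeing with
  \<open>X\<close> there. The inclusion has the form that \<open>norm_opt\<close> asks for.\<close>

lemma ex_normal_form_gamb:
  "wf_tree t \<Longrightarrow> X \<in> gamb t \<Longrightarrow> \<exists>u. normal_form u t \<and> gamb u \<subseteq> {X}"
proof (induction t arbitrary: X)
  case (Decision m)
  then obtain i t where t: "fmlookup m i = Some t" "X \<in> gamb t" unfolding mem_gamb_Decision by blast
  with Decision obtain v where v: "normal_form v t" "gamb v \<subseteq> {X}"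
    by (metis fmran'I wf_tree_simps(2))
  have "gamb (Decision (fmupd i v fmempty)) \<subseteq> {X}"
    using v by (auto simp: mem_gamb_Decision simp del: gamb.simps split: if_splits)
  with t v show ?case unfolding normal_form_Decision by blast
next
  case (Chance m)
  \<comment> \<open>A gamble of the branch may differ from \<open>X\<close> outside
    \<open>E\<close>, so agreement is recorded on \<open>E\<close> only; this suffices since the
    events cover everything.\<close>
  have "\<exists>u. normal_form u t \<and> (\<forall>Y \<in> gamb u. \<forall>\<omega> \<in> E. Y \<omega> = X \<omega>)" if t: "fmlookup m E = Some t" for E t
  proof -
    from t Chance.prems obtain Y where Y: "Y \<in> gamb t" "\<forall>\<omega> \<in> E. X \<omega> = Y \<omega>"
      unfolding mem_gamb_Chance by blast
    with Chance t obtain u where "normal_form u t" "gamb u \<subseteq> {Y}"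
      by (metis fmran'I wf_tree_simps(3))
    with Y show ?thesis by (intro exI[of _ u]) auto
  qed
  then obtain f where f: "\<And>E t. fmlookup m E = Some t \<Longrightarrow>
      normal_form (f E t) t \<and> (\<forall>Y \<in> gamb (f E t). \<forall>\<omega> \<in> E. Y \<omega> = X \<omega>)"
    by metis
  let ?m = "fmmap_keys f m"
  have "fmrel normal_form ?m m" using f by (intro fmrelI) auto
  moreover have "gamb (Chance ?m) \<subseteq> {X}"
  proof
    fix Z assume Z: "Z \<in> gamb (Chance ?m)"
    have "Z \<omega> = X \<omega>" for \<omega>
    proof -
      from Chance.prems obtain E t where E: "\<omega> \<in> E" "fmlookup m E = Some t"
        unfolding wf_tree_simps partition_on_def by (metis UNIV_I UnionE fmlookup_dom'_iff)
      then have "fmlookup ?m E = Some (f E t)" by simp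
      with Z E f[OF E(2)] show ?thesis unfolding mem_gamb_Chance by metis
    qed
    then show "Z \<in> {X}" by auto
  qed
  ultimately show ?case unfolding normal_form_Chance by blast
qed (simp add: normal_form_Reward)

section \<open>Optimal decisions across decision and chance nodes\<close>

lemma norm_opt_nonempty:
  fixes opt :: "('w::finite, 'r) gamble set \<Rightarrow> 'w set \<Rightarrow> ('w, 'r) gamble set"
  assumes "choice_function opt" "consistent (A, t)"
  shows "\<exists>u. (A, u) \<in> norm_opt opt (A, t)"
proof -
  note wf = consistent_wf[OF assms(2)]
  have "opt (gamb t) A \<noteq> {} \<and> opt (gamb t) A \<subseteq> gamb t"
    using assms(1) consistent_ev[OF assms(2)] finite_gamb[OF wf] gamb_nonempty[OF wf]
    unfolding choice_function_def by simp
  \<comment> \<open>Any optimal gamble will do: a normal form decision with no gamble other than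
    \<open>X\<close> is optimal.\<close>
  then obtain X where X: "X \<in> opt (gamb t) A" "X \<in> gamb t" by blast
  with ex_normal_form_gamb[OF wf] obtain u where "normal_form u t" "gamb u \<subseteq> {X}" by blast
  with X(1) have "(A, u) \<in> norm_opt opt (A, t)" unfolding mem_norm_opt by blast
  then show ?thesis ..
qed

text \<open>The premise on \<open>v\<close> places the child at \<open>i\<close> inside some optimal
  decision, as subtree perfectness at \<open>[Decision_Arc i]\<close> demands. The equivalence then
  holds for every \<open>w\<close>, whatever \<open>v\<close> was.\<close>

lemma norm_opt_Decision_subtree:
  assumes "normal_form_subtree_perfect (norm_opt opt)"
    and "consistent (A, Decision m)"
    and "(A, Decision (fmupd i v fmempty)) \<in> norm_opt opt (A, Decision m)"
    and "fmlookup m i = Some t"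
  shows "(A, w) \<in> norm_opt opt (A, t) \<longleftrightarrow>
    (A, Decision (fmupd i w fmempty)) \<in> norm_opt opt (A, Decision m)" (is "_ \<longleftrightarrow> ?R")
proof -
  let ?N = "[Decision_Arc i]"
  have "?N \<in> nodes (A, Decision (fmupd i v fmempty))" by (simp add: nodes_simps)
  with assms have "st_set ?N (norm_opt opt (A, Decision m)) = norm_opt opt (st ?N (A, Decision m))"
    unfolding normal_form_subtree_perfect_def by blast
  also have "st ?N (A, Decision m) = (A, t)" using assms(4) by (simp add: st_simps)
  finally have "(A, w) \<in> norm_opt opt (A, t) \<longleftrightarrow> (A, w) \<in> st_set ?N (norm_opt opt (A, Decision m))"
    by simp
  also have "\<dots> \<longleftrightarrow> ?R"
  proof
    assume "(A, w) \<in> st_set ?N (norm_opt opt (A, Decision m))"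
    then obtain u where u: "(A, u) \<in> norm_opt opt (A, Decision m)" "?N \<in> nodes (A, u)"
      "(A, w) = st ?N (A, u)"
      unfolding st_set_def by (auto simp: mem_norm_opt)
    \<comment> \<open>A normal form decision keeps one arc, so containing the child at
      \<open>i\<close> forces \<open>j = i\<close>.\<close>
    then obtain j x where "u = Decision (fmupd j x fmempty)"
      unfolding mem_norm_opt normal_form_Decision by blast
    with u show ?R by (auto simp: nodes_simps st_simps split: if_splits)
  next
    assume R: ?R
    have "st ?N (A, Decision (fmupd i w fmempty)) = (A, w)" by (simp add: st_simps)
    with R show "(A, w) \<in> st_set ?N (norm_opt opt (A, Decision m))"
      unfolding st_set_def by (force simp: nodes_simps)
  qed
  finally show ?thesis .
qed

text \<open>Chance nodes keep all arcs, so any optimal \<open>u\<close> contains the child at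
  \<open>E\<close> and subtree perfectness applies. It controls only the branch at \<open>E\<close>;
  the other branches of \<open>M\<close> stay existential.\<close>

lemma norm_opt_Chance_subtree:
  assumes "normal_form_subtree_perfect (norm_opt opt)"
    and "consistent (A, Chance m)"
    and "(A, u) \<in> norm_opt opt (A, Chance m)"
    and "fmlookup m E = Some t"
  shows "(A \<inter> E, w) \<in> norm_opt opt (A \<inter> E, t) \<longleftrightarrow>
    (\<exists>M. (A, Chance M) \<in> norm_opt opt (A, Chance m) \<and> fmlookup M E = Some w)" (is "_ \<longleftrightarrow> ?R")
proof -
  let ?N = "[Chance_Arc E]"
  obtain M where M: "u = Chance M" "fmrel normal_form M m"
    using assms(3) by (auto simp: mem_norm_opt normal_form_Chance)
  from fmrelD(2)[OF M(2) assms(4)] have "?N \<in> nodes (A, u)"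
    by (auto simp: M(1) nodes_simps)
  with assms have "st_set ?N (norm_opt opt (A, Chance m)) = norm_opt opt (st ?N (A, Chance m))"
    unfolding normal_form_subtree_perfect_def by blast
  also have "st ?N (A, Chance m) = (A \<inter> E, t)" using assms(4) by (simp add: st_simps)
  finally have "(A \<inter> E, w) \<in> norm_opt opt (A \<inter> E, t) \<longleftrightarrow>
      (A \<inter> E, w) \<in> st_set ?N (norm_opt opt (A, Chance m))"
    by simp
  also have "\<dots> \<longleftrightarrow> ?R"
  proof
    assume "(A \<inter> E, w) \<in> st_set ?N (norm_opt opt (A, Chance m))"
    then obtain u where u: "(A, u) \<in> norm_opt opt (A, Chance m)" "?N \<in> nodes (A, u)"
      "(A \<inter> E, w) = st ?N (A, u)"
      unfolding st_set_def by (auto simp: mem_norm_opt)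
    then obtain M where "u = Chance M"
      unfolding mem_norm_opt normal_form_Chance by blast
    with u show ?R by (auto simp: nodes_simps st_simps)
  next
    assume ?R
    then obtain M where M: "(A, Chance M) \<in> norm_opt opt (A, Chance m)" "fmlookup M E = Some w" by blast
    then have "st ?N (A, Chance M) = (A \<inter> E, w)" by (simp add: st_simps)
    with M show "(A \<inter> E, w) \<in> st_set ?N (norm_opt opt (A, Chance m))"
      unfolding st_set_def by (force simp: nodes_simps)
  qed
  finally show ?thesis .
qed

text \<open>In contrast to \<open>norm_opt_Chance_subtree\<close>, the branches other than
  \<open>E\<close> are prescribed here. Iterating this exchange gives the product form of
  \<open>norm_opt\<close> at a chance node.\<close>

lemma norm_opt_Chance_fmupd:
  assumes perfect: "normal_form_subtree_perfect (norm_opt opt)"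
    and cons: "consistent (A, Chance m)"
    and M: "(A, Chance M) \<in> norm_opt opt (A, Chance m)"
    and E: "fmlookup m E = Some t"
    and v: "(A \<inter> E, v) \<in> norm_opt opt (A \<inter> E, t)"
  shows "(A, Chance (fmupd E v M)) \<in> norm_opt opt (A, Chance m)"
proof -
  have r: "fmrel normal_form M m" using M by (simp add: mem_norm_opt normal_form_Chance)
  \<comment> \<open>\<open>m0\<close> is \<open>M\<close> with the branch at \<open>E\<close> reset
    to the undecided \<open>t\<close>. In \<open>D\<close>, arc 0 leads to this partly decided tree
    and arc 1 to the original one.\<close>
  define m0 where "m0 = fmupd E t M"
  define D where "D = fmupd (0::nat) (Chance m0) (fmupd 1 (Chance m) fmempty)"
  have m_E: "fmupd E t m = m" using E by (intro fmap_ext) auto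
  have "fmrel pruning M m" using r by (rule fmap.rel_mono_strong) (simp add: normal_form_def)
  moreover have "pruning t t" using cons E by (auto simp: consistent_Chance intro: pruning_refl consistent_wf)
  ultimately have "fmrel pruning m0 m" unfolding m0_def using fmrel_upd m_E by metis
  then have p0: "pruning (Chance m0) (Chance m)" by (simp add: pruning_simps)
  note c0 = pruning_consistent[OF cons p0]
  \<comment> \<open>Arc 0 adds no gamble to those of arc 1, so \<open>opt\<close> sees the same set
    and the same event at \<open>D\<close> as at \<open>Chance m\<close>.\<close>
  have "gamb (Decision D) = gamb (Chance m0) \<union> gamb (Chance m)"
    unfolding set_eq_iff Un_iff mem_gamb_Decision by (auto simp: D_def simp del: gamb.simps)
  with pruning_gamb[OF p0] have gD: "gamb (Decision D) = gamb (Chance m)" by blast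
  have D0: "fmlookup D 0 = Some (Chance m0)" by (simp add: D_def)
  then have "D \<noteq> fmempty" by auto
  then have cD: "consistent (A, Decision D)"
    using c0 cons consistent_ev[OF cons]
    by (auto simp: consistent_Decision D_def split: if_splits)
  \<comment> \<open>Hence a decision through arc 0 is judged by optimality among the gambles of
    \<open>Chance m\<close>, although it is built inside \<open>Chance m0\<close>.\<close>
  have arc: "(A, Decision (fmupd 0 u fmempty)) \<in> norm_opt opt (A, Decision D) \<longleftrightarrow>
      normal_form u (Chance m0) \<and> gamb u \<subseteq> opt (gamb (Chance m)) A" for u
  proof -
    have "gamb (Decision (fmupd 0 u fmempty)) = gamb u"
      unfolding set_eq_iff mem_gamb_Decision by (auto split: if_splits)
    moreover have "fmupd (0::nat) u fmempty = fmupd i w fmempty \<longleftrightarrow> i = 0 \<and> w = u" for i w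
      by (metis fmempty_lookup fmupd_lookup option.distinct(1) option.inject)
    ultimately show ?thesis
      unfolding mem_norm_opt gD normal_form_Decision using D0 by auto
  qed
  \<comment> \<open>The branches of \<open>M\<close> are fully decided, so each is a normal form
    decision of itself.\<close>
  have fixed: "fmlookup M F = Some w \<Longrightarrow> single_arcs w \<and> normal_form w w" for F w
    using fmrelD(1)[OF r, of F w] cons unfolding normal_form_def consistent_Chance
    by (metis consistent_wf pruning_consistent pruning_refl)
  have "fmrel normal_form M m0"
  proof (rule fmrelI)
    fix F w assume w: "fmlookup M F = Some w"
    with fmrelD(1)[OF r w] E fixed[OF w] show "\<exists>s. fmlookup m0 F = Some s \<and> normal_form w s"
      by (auto simp: m0_def)
  next
    fix F s assume "fmlookup m0 F = Some s"
    with fmrelD(2)[OF r E] show "\<exists>w. fmlookup M F = Some w" by (auto simp: m0_def split: if_splits)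
  qed
  \<comment> \<open>\<open>M\<close> itself witnesses that arc 0 occurs in an optimal decision of
    \<open>D\<close>. This unlocks subtree perfectness there and identifies optimality in
    \<open>Chance m0\<close> with optimality through arc 0.\<close>
  then have "(A, Decision (fmupd 0 (Chance M) fmempty)) \<in> norm_opt opt (A, Decision D)"
    using M unfolding arc by (simp add: normal_form_Chance mem_norm_opt)
  note sub0 = norm_opt_Decision_subtree[OF perfect cD this D0]
  have "(A, Chance M) \<in> norm_opt opt (A, Chance m0)"
    unfolding sub0 by fact
  from norm_opt_Chance_subtree[OF perfect c0 this, of E t v] v obtain W where
    W: "(A, Chance W) \<in> norm_opt opt (A, Chance m0)" "fmlookup W E = Some v"
    by (auto simp: m0_def)
  have rW: "fmrel normal_form W m0" using W(1) by (simp add: mem_norm_opt normal_form_Chance)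
  \<comment> \<open>Away from \<open>E\<close> the branches of \<open>m0\<close> are those of
    \<open>M\<close> and leave no freedom, so the existential \<open>W\<close> is
    determined.\<close>
  have "W = fmupd E v M"
  proof (rule fmap_ext)
    fix F
    show "fmlookup W F = fmlookup (fmupd E v M) F"
    proof (cases "F = E")
      case False
      then have "fmlookup m0 F = fmlookup M F" by (simp add: m0_def)
      show ?thesis
      proof (cases "fmlookup M F")
        case None
        with \<open>fmlookup m0 F = fmlookup M F\<close> fmrelD(1)[OF rW] have "fmlookup W F = None"
          by (metis not_Some_eq)
        with None False show ?thesis by simp
      next
        case (Some w)
        with \<open>fmlookup m0 F = fmlookup M F\<close> fmrelD(2)[OF rW] obtain x where
          x: "fmlookup W F = Some x" "normal_form x w" by metis
        with Some fixed normal_form_single_arcs have "x = w" by blast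
        with x Some False show ?thesis by simp
      qed
    qed (simp add: W)
  qed
  moreover have "gamb (Chance W) \<subseteq> opt (gamb (Chance m)) A"
    using W(1) unfolding sub0 arc by blast
  moreover have "fmrel normal_form (fmupd E v M) m"
    using fmrel_upd[OF r] v m_E by (metis mem_norm_opt)
  ultimately show ?thesis by (simp add: mem_norm_opt normal_form_Chance)
qed

text \<open>Left to right is subtree perfectness at each branch. For the converse, some optimal
  decision exists, and its branches are replaced by those of \<open>M\<close> one event at a
  time.\<close>

lemma norm_opt_Chance:
  fixes opt :: "('w::finite, 'r) gamble set \<Rightarrow> 'w set \<Rightarrow> ('w, 'r) gamble set"
  assumes "choice_function opt"
    and perfect: "normal_form_subtree_perfect (norm_opt opt)"
    and cons: "consistent (A, Chance m)"
  shows "(A, u) \<in> norm_opt opt (A, Chance m) \<longleftrightarrow>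
    (\<exists>M. u = Chance M \<and> fmdom' M = fmdom' m \<and>
      (\<forall>E t w. fmlookup m E = Some t \<longrightarrow> fmlookup M E = Some w \<longrightarrow>
         (A \<inter> E, w) \<in> norm_opt opt (A \<inter> E, t)))" (is "?L \<longleftrightarrow> ?R")
proof
  assume L: ?L
  then obtain M where M: "u = Chance M" "fmrel normal_form M m"
    by (auto simp: mem_norm_opt normal_form_Chance)
  then have "fmdom' M = fmdom' m" by (auto dest: fmrel_fmdom'_eq)
  with M norm_opt_Chance_subtree[OF perfect cons L] L show ?R by blast
next
  assume ?R
  then obtain M where u: "u = Chance M" and dom: "fmdom' M = fmdom' m"
    and M: "\<And>E t w. fmlookup m E = Some t \<Longrightarrow> fmlookup M E = Some w \<Longrightarrow>
         (A \<inter> E, w) \<in> norm_opt opt (A \<inter> E, t)" by blast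
  \<comment> \<open>\<open>S\<close> is the set of events already treated; on it the optimal
    \<open>M'\<close> agrees with the target \<open>M\<close>.\<close>
  have "\<exists>M'. (A, Chance M') \<in> norm_opt opt (A, Chance m) \<and> (\<forall>E \<in> S. fmlookup M' E = fmlookup M E)"
    if "finite S" "S \<subseteq> fmdom' m" for S
    using that
  proof (induction S)
    case empty
    with norm_opt_nonempty[OF assms(1) cons] show ?case
      by (auto simp: mem_norm_opt normal_form_Chance)
  next
    case (insert E S)
    then obtain M' where M': "(A, Chance M') \<in> norm_opt opt (A, Chance m)"
      "\<forall>E \<in> S. fmlookup M' E = fmlookup M E" by auto
    from insert dom obtain t w where tw: "fmlookup m E = Some t" "fmlookup M E = Some w"
      by (metis fmlookup_dom'_iff insert_subset)
    from norm_opt_Chance_fmupd[OF perfect cons M'(1) tw(1) M[OF tw]] M'(2) tw(2)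
    show ?case by (intro exI[of _ "fmupd E w M'"]) auto
  qed
  from this[of "fmdom' m"] obtain M' where
    M': "(A, Chance M') \<in> norm_opt opt (A, Chance m)" "\<forall>E \<in> fmdom' m. fmlookup M' E = fmlookup M E"
    by auto
  from M'(1) have "fmrel normal_form M' m" by (simp add: mem_norm_opt normal_form_Chance)
  then have "fmdom' M' = fmdom' m" by (auto dest: fmrel_fmdom'_eq)
  with M'(2) dom have "M' = M" by (intro fmap_ext) (metis fmdom'_notD)
  with M' u show ?L by simp
qed

section \<open>The extensive form operator built from optimal arcs\<close>

definition optimal_arcs ::
    "(('w, 'r) gamble set \<Rightarrow> 'w set \<Rightarrow> ('w, 'r) gamble set) \<Rightarrow> 'w set \<Rightarrow>
      (nat, ('w, 'r) tree) fmap \<Rightarrow> nat set" where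
  "optimal_arcs opt A m =
     {i. \<exists>v. (A, Decision (fmupd i v fmempty)) \<in> norm_opt opt (A, Decision m)}"

text \<open>The event is an argument of the recursive result, so that it can shrink to
  \<open>A \<inter> E\<close> below a chance arc while the recursion stays primitive in the
  tree.\<close>

primrec ext_opt ::
    "(('w, 'r) gamble set \<Rightarrow> 'w set \<Rightarrow> ('w, 'r) gamble set) \<Rightarrow> ('w, 'r) tree \<Rightarrow> 'w set \<Rightarrow>
      ('w, 'r) tree" where
  "ext_opt opt (Reward r) = (\<lambda>A. Reward r)"
| "ext_opt opt (Decision m) =
     (\<lambda>A. Decision (fmrestrict_set (optimal_arcs opt A m) (fmmap (\<lambda>f. f A) (fmmap (ext_opt opt) m))))"
| "ext_opt opt (Chance m) =
     (\<lambda>A. Chance (fmmap_keys (\<lambda>E f. f (A \<inter> E)) (fmmap (ext_opt opt) m)))"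

lemma optimal_arcs_nonempty:
  fixes opt :: "('w::finite, 'r) gamble set \<Rightarrow> 'w set \<Rightarrow> ('w, 'r) gamble set"
  assumes "choice_function opt" "consistent (A, Decision m)"
  shows "optimal_arcs opt A m \<noteq> {}"
proof -
  obtain u where u: "(A, u) \<in> norm_opt opt (A, Decision m)"
    using norm_opt_nonempty[OF assms] ..
  then obtain i v where "u = Decision (fmupd i v fmempty)"
    unfolding mem_norm_opt normal_form_Decision by blast
  with u show ?thesis unfolding optimal_arcs_def by blast
qed

lemma optimal_arcs_subset: "optimal_arcs opt A m \<subseteq> fmdom' m"
proof
  fix i assume "i \<in> optimal_arcs opt A m"
  then obtain v where "normal_form (Decision (fmupd i v fmempty)) (Decision m)"
    by (auto simp: optimal_arcs_def mem_norm_opt)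
  then obtain j t w where "fmlookup m j = Some t"
    and eq: "fmupd i v fmempty = fmupd j w fmempty"
    unfolding normal_form_Decision tree.inject by blast
  moreover have "i = j" using arg_cong[OF eq, of fmdom'] by simp
  ultimately show "i \<in> fmdom' m" by (auto intro: fmdom'I)
qed

text \<open>Consistency makes the event at each node non-empty, so an optimal arc exists there and
  \<open>optimal_arcs\<close> is a legitimate set of arcs to keep.\<close>

lemma ext_opt_pruning:
  fixes opt :: "('w::finite, 'r) gamble set \<Rightarrow> 'w set \<Rightarrow> ('w, 'r) gamble set"
  assumes "choice_function opt"
  shows "consistent (A, t) \<Longrightarrow> pruning (ext_opt opt t A) t"
proof (induction t arbitrary: A)
  case (Decision m)
  let ?I = "optimal_arcs opt A m"
  have "pruning (ext_opt opt t A) t" if "fmlookup m i = Some t" for i t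
    using that Decision unfolding consistent_Decision by (meson fmran'I)
  then have "fmrel pruning (fmrestrict_set ?I (fmmap (\<lambda>f. f A) (fmmap (ext_opt opt) m))) (fmrestrict_set ?I m)"
    by (intro fmrelI) (auto split: if_splits)
  with optimal_arcs_nonempty[OF assms Decision.prems] optimal_arcs_subset show ?case
    unfolding ext_opt.simps by (rule pruning.intros(2))
next
  case (Chance m)
  have "pruning (ext_opt opt t (A \<inter> E)) t" if "fmlookup m E = Some t" for E t
    using that Chance unfolding consistent_Chance by (meson fmran'I)
  then have "fmrel pruning (fmmap_keys (\<lambda>E f. f (A \<inter> E)) (fmmap (ext_opt opt) m)) m"
    by (intro fmrelI) auto
  then show ?case unfolding pruning_simps by auto
qed (simp add: pruning_simps)

lemma ext_opt_normal_form:
  fixes opt :: "('w::finite, 'r) gamble set \<Rightarrow> 'w set \<Rightarrow> ('w, 'r) gamble set"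
  assumes opt: "choice_function opt"
    and perfect: "normal_form_subtree_perfect (norm_opt opt)"
  shows "consistent (A, t) \<Longrightarrow>
    (A, u) \<in> norm_opt opt (A, t) \<longleftrightarrow> normal_form u (ext_opt opt t A)"
proof (induction t arbitrary: u A)
  case (Reward r)
  \<comment> \<open>A leaf is its own only normal form decision, so non-emptiness makes it
    optimal.\<close>
  from norm_opt_nonempty[OF opt Reward] show ?case
    by (auto simp: mem_norm_opt normal_form_Reward)
next
  case (Decision m)
  have IH: "(A, v) \<in> norm_opt opt (A, t) \<longleftrightarrow> normal_form v (ext_opt opt t A)"
    if "fmlookup m i = Some t" for i t v
    using that Decision unfolding consistent_Decision by (meson fmran'I)
  note sub = norm_opt_Decision_subtree[OF perfect Decision.prems]
  show ?case
  proof
    assume u: "(A, u) \<in> norm_opt opt (A, Decision m)"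
    then obtain i t v where t: "fmlookup m i = Some t" and uv: "u = Decision (fmupd i v fmempty)"
      unfolding mem_norm_opt normal_form_Decision by blast
    have "i \<in> optimal_arcs opt A m" using u uv by (auto simp: optimal_arcs_def)
    moreover have "normal_form v (ext_opt opt t A)" using sub[of i v t v] u uv t IH by blast
    ultimately show "normal_form u (ext_opt opt (Decision m) A)"
      using t uv by (auto simp: normal_form_Decision)
  next
    assume "normal_form u (ext_opt opt (Decision m) A)"
    then obtain i t v where t: "fmlookup m i = Some t" and i: "i \<in> optimal_arcs opt A m"
      and v: "normal_form v (ext_opt opt t A)" and uv: "u = Decision (fmupd i v fmempty)"
      by (auto simp: normal_form_Decision split: if_splits)
    \<comment> \<open>The arc \<open>i\<close> is optimal through some \<open>w\<close>, possibly
      different from \<open>v\<close>; subtree perfectness then admits every optimal decision of the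
      child, in particular \<open>v\<close>.\<close>
    from i obtain w where "(A, Decision (fmupd i w fmempty)) \<in> norm_opt opt (A, Decision m)"
      by (auto simp: optimal_arcs_def)
    from sub[OF this t] IH[OF t] v uv show "(A, u) \<in> norm_opt opt (A, Decision m)" by blast
  qed
next
  case (Chance m)
  let ?m = "fmmap_keys (\<lambda>E f. f (A \<inter> E)) (fmmap (ext_opt opt) m)"
  have IH: "(A \<inter> E, v) \<in> norm_opt opt (A \<inter> E, t) \<longleftrightarrow> normal_form v (ext_opt opt t (A \<inter> E))"
    if "fmlookup m E = Some t" for E t v
    using that Chance unfolding consistent_Chance by (meson fmran'I)
  have "fmrel normal_form M ?m \<longleftrightarrow> fmdom' M = fmdom' m \<and>
      (\<forall>E t w. fmlookup m E = Some t \<longrightarrow> fmlookup M E = Some w \<longrightarrow>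
         (A \<inter> E, w) \<in> norm_opt opt (A \<inter> E, t))" (is "_ \<longleftrightarrow> ?R") for M
  proof
    assume r: "fmrel normal_form M ?m"
    have "fmdom' M = fmdom' ?m" using fmrel_fmdom'_eq[OF r] .
    then have "fmdom' M = fmdom' m" by (auto simp: fmlookup_dom'_iff set_eq_iff)
    with fmrelD(1)[OF r] IH show ?R by fastforce
  next
    assume ?R
    then show "fmrel normal_form M ?m"
      using IH by (intro fmrelI) (fastforce simp: fmlookup_dom'_iff set_eq_iff)+
  qed
  then show ?case
    unfolding norm_opt_Chance[OF opt perfect Chance.prems] by (simp add: normal_form_Chance)
qed

text \<open>\<open>ext_opt\<close> prunes below a node by looking only at the subtree and the event
  there, so it commutes with passing to subtrees. Consistency of the subtree is carried along
  because the final operator distinguishes consistent trees.\<close>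

lemma ext_opt_subtree:
  "consistent (A, t) \<Longrightarrow> N \<in> nodes (A, ext_opt opt t A) \<Longrightarrow>
    \<exists>B s. st N (A, t) = (B, s) \<and> consistent (B, s) \<and>
      st N (A, ext_opt opt t A) = (B, ext_opt opt s B)"
proof (induction N arbitrary: A t)
  case (Cons a N)
  show ?case
  proof (cases t)
    case (Reward r)
    then show ?thesis using Cons.prems by (simp add: nodes_simps)
  next
    case (Decision m)
    with Cons.prems(2) obtain i s where a: "a = Decision_Arc i" and s: "fmlookup m i = Some s"
      and i: "i \<in> optimal_arcs opt A m" and N: "N \<in> nodes (A, ext_opt opt s A)"
      by (cases a) (auto simp: nodes_simps split: if_splits)
    with Cons.prems(1) Cons.IH[OF _ N] show ?thesis
      by (simp add: Decision consistent_Decision st_simps)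
  next
    case (Chance m)
    with Cons.prems(2) obtain E s where a: "a = Chance_Arc E" and s: "fmlookup m E = Some s"
      and N: "N \<in> nodes (A \<inter> E, ext_opt opt s (A \<inter> E))"
      by (cases a) (auto simp: nodes_simps)
    with Cons.prems(1) Cons.IH[OF _ N] show ?thesis
      by (simp add: Chance consistent_Chance st_simps)
  qed
qed (simp add: st_simps)

theorem theorem32:
  fixes opt :: "('w::finite, 'r) gamble set \<Rightarrow> 'w set \<Rightarrow> ('w, 'r) gamble set"
  assumes "choice_function opt"
    and "normal_form_subtree_perfect (norm_opt opt)"
  shows "\<exists>ext :: ('w, 'r) dtree \<Rightarrow> ('w, 'r) dtree.
    extensive_form_operator ext \<and>
    extensive_form_subtree_perfect ext \<and>
    (\<forall>T. consistent T \<longrightarrow> norm_opt opt T = nfd (ext T))"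
proof -
  \<comment> \<open>With an empty event \<open>opt\<close> is unconstrained and
    \<open>ext_opt\<close> might keep no arc, so inconsistent trees are left unpruned; a well-formed
    tree is an extensive form solution of itself.\<close>
  define ext :: "('w, 'r) dtree \<Rightarrow> ('w, 'r) dtree" where
    "ext T = (if consistent T then (fst T, ext_opt opt (snd T) (fst T)) else T)" for T
  have "extensive_form_operator ext"
    using ext_opt_pruning[OF assms(1)] pruning_refl
    by (auto simp: extensive_form_operator_def extensive_form_solutions_def decision_tree_def ext_def ev_def)
  moreover have "extensive_form_subtree_perfect ext"
    unfolding extensive_form_subtree_perfect_def
    using ext_opt_subtree by (fastforce simp: ext_def)
  moreover have "norm_opt opt T = nfd (ext T)" if "consistent T" for T
  proof -
    obtain A t where T: "T = (A, t)" by (cases T)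
    with that have "consistent (A, t)" by simp
    from ext_opt_normal_form[OF assms this] show ?thesis
      by (auto simp: T ext_def that[unfolded T] mem_nfd) (auto simp: mem_norm_opt)
  qed
  ultimately show ?thesis by blast
qed

end
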